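(* Let $f,g,c$ satisfy the standing assumption on the composite problem (P), $\min_x\Phi(x)=f(x)+g(c(x))$. Let all minimizers of (P) be nonstationary, and let the value function $\mathcal V(u)=\inf_x\{f(x)+g(c(x)-u)\}$, $u\in\mathbb R^m$, be proper and lower semicontinuous. Let $\{(x^k,z^k,y^k)\}$ be a sequence generated by the classical augmented Lagrangian method (described in the context) such that $\sum_{k=0}^\infty\sqrt{\varepsilon_k/\mu_k}<\infty$. Then $c(x^k)-z^k\to0$, $\|y^k\|\to\infty$, and $$\liminf_{k\to\infty}\left(f(x^k)+g(z^k)\right)\le\Phi^\star .$$ If $\{x^k\}$ is bounded, then there exist an accumulation point $\bar x\in\mathbb R^n$ and a subsequence $\{x^k\}_{k\in K}$ ($K\subseteq\mathbb N$ infinite) such that $x^k\to\bar x$ as $k\to\infty$, $k\in K$, $\bar x$ is a minimizer of (P), and $z^k\to c(\bar x)$ and $f(x^k)+g(z^k)\to\Phi^\star$ as $k\to\infty$, $k\in K$.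
   Context: Spaces $\mathbb R^n,\mathbb R^m$ carry the Euclidean inner product $\langle\cdot,\cdot\rangle$ and norm $\|\cdot\|$; $\overline{\mathbb R}=\mathbb R\cup\{+\infty\}$. For a proper lsc convex $g:\mathbb R^m\to\overline{\mathbb R}$, the horizon is $\operatorname{hzn} g=\{v\in\mathbb R^m : g(z+v)\le g(z)\ \forall z\in\operatorname{dom} g\}$. Standing assumption: $f:\mathbb R^n\to\mathbb R$ is continuously differentiable and convex; $g:\mathbb R^m\to\overline{\mathbb R}$ is proper, lsc, convex; $c:\mathbb R^n\to\mathbb R^m$ is continuously differentiable and $(-\operatorname{hzn} g)$-convex, i.e. $c(\lambda x+(1-\lambda)x')-\lambda c(x)-(1-\lambda)c(x')\in\operatorname{hzn} g$ for all $x,x'\in\mathbb R^n$, $\lambda\in[0,1]$; (P) is feasible and possesses a minimizer, with minimal value $\Phi^\star$. A feasible point $\bar x$ is stationary if there is $\bar y\in\partial g(c(\bar x))$ with $\nabla f(\bar x)+c'(\bar x)^\top\bar y=0$; otherwise it is nonstationary. For $\mu>0$ the augmented Lagrangian is $L_\mu(x,y)=f(x)+g^\mu(c(x)+\mu y)-\frac\mu2\|y\|^2$, where $g^\mu(z)=\inf_w\{g(w)+\frac1{2\mu}\|w-z\|^2\}$. $\operatorname{prox}_\varphi(z)$ is the unique minimizer of $w\mapsto\varphi(w)+\frac12\|w-z\|^2$. Classical ALM. Data: $\mu_0>0$; $y^0\in\mathbb R^m$; $\beta\in(0,1)$. For $k=0,1,2,\dots$: select $\varepsilon_k\ge0$ and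 $x^k\in\mathbb R^n$ with $L_{\mu_k}(x^k,y^k)\le\inf_xL_{\mu_k}(x,y^k)+\varepsilon_k$; set $z^k=\operatorname{prox}_{\mu_kg}(c(x^k)+\mu_ky^k)$; set $y^{k+1}=y^k+\mu_k^{-1}(c(x^k)-z^k)$; set $\mu_{k+1}=\beta_k\mu_k$ for some $\beta_k\in(0,\beta]\cup\{1\}$. *)

theory Defs
  imports "HOL-Analysis.Analysis"
begin

text \<open>Extended-real-valued functions take values in \<^typ>\<open>ereal\<close>; the value minus infinity is
  excluded by properness. Note that in \<^typ>\<open>ereal\<close> zero times infinity is zero.\<close>

definition effective_domain :: "('a \<Rightarrow> ereal) \<Rightarrow> 'a set" where
  "effective_domain h = {z. h z < \<infinity>}"

definition proper_fun :: "('a \<Rightarrow> ereal) \<Rightarrow> bool" where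
  "proper_fun h \<longleftrightarrow> (\<forall>z. h z \<noteq> -\<infinity>) \<and> effective_domain h \<noteq> {}"

definition lsc_fun :: "('a::topological_space \<Rightarrow> ereal) \<Rightarrow> bool" where
  "lsc_fun h \<longleftrightarrow> (\<forall>z. h z \<le> Liminf (nhds z) h)"

definition convex_fun :: "('a::real_vector \<Rightarrow> ereal) \<Rightarrow> bool" where
  "convex_fun h \<longleftrightarrow> (\<forall>z w. \<forall>u\<ge>0. \<forall>v\<ge>0. u + v = 1 \<longrightarrow>
     h (u *\<^sub>R z + v *\<^sub>R w) \<le> ereal u * h z + ereal v * h w)"

definition horizon :: "('a::plus \<Rightarrow> ereal) \<Rightarrow> 'a set" where
  "horizon g = {v. \<forall>z\<in>effective_domain g. g (z + v) \<le> g z}"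

definition subdifferential :: "('a::real_inner \<Rightarrow> ereal) \<Rightarrow> 'a \<Rightarrow> 'a set" where
  "subdifferential g z =
     {y. z \<in> effective_domain g \<and> (\<forall>w. g z + ereal (y \<bullet> (w - z)) \<le> g w)}"

definition continuously_differentiable ::
    "('a::real_normed_vector \<Rightarrow> 'b::real_normed_vector) \<Rightarrow> bool" where
  "continuously_differentiable h \<longleftrightarrow>
     (\<exists>h' :: 'a \<Rightarrow> 'a \<Rightarrow>\<^sub>L 'b. (\<forall>x. (h has_derivative blinfun_apply (h' x)) (at x)) \<and>
        continuous_on UNIV h')"

definition gradient :: "('a::real_inner \<Rightarrow> real) \<Rightarrow> 'a \<Rightarrow> 'a" where
  "gradient f x = (THE d. GDERIV f x :> d)"

text \<open>The predicate says that \<^term>\<open>c\<close> is convex with respect to the cone \<^emph>\<open>minus\<close> \<^term>\<open>K\<close>; it is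
  used with \<^term>\<open>K\<close> the horizon of \<^term>\<open>g\<close>.\<close>

definition neg_cone_convex :: "'b set \<Rightarrow> ('a::real_vector \<Rightarrow> 'b::real_vector) \<Rightarrow> bool" where
  "neg_cone_convex K c \<longleftrightarrow> (\<forall>x x'. \<forall>l\<in>{0..1::real}.
     c (l *\<^sub>R x + (1 - l) *\<^sub>R x') - l *\<^sub>R c x - (1 - l) *\<^sub>R c x' \<in> K)"

definition objective :: "('a \<Rightarrow> real) \<Rightarrow> ('b \<Rightarrow> ereal) \<Rightarrow> ('a \<Rightarrow> 'b) \<Rightarrow> 'a \<Rightarrow> ereal" where
  "objective f g c x = ereal (f x) + g (c x)"

definition feasible :: "('b \<Rightarrow> ereal) \<Rightarrow> ('a \<Rightarrow> 'b) \<Rightarrow> 'a \<Rightarrow> bool" where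
  "feasible g c x \<longleftrightarrow> c x \<in> effective_domain g"

definition minimizer :: "('a \<Rightarrow> ereal) \<Rightarrow> 'a \<Rightarrow> bool" where
  "minimizer h x \<longleftrightarrow> is_arg_min h (\<lambda>_. True) x"

definition stationary ::
    "(real^'n \<Rightarrow> real) \<Rightarrow> (real^'m \<Rightarrow> ereal) \<Rightarrow> (real^'n \<Rightarrow> real^'m) \<Rightarrow> real^'n \<Rightarrow> bool" where
  "stationary f g c x \<longleftrightarrow> feasible g c x \<and>
     (\<exists>y\<in>subdifferential g (c x). gradient f x + transpose (jacobian c (at x)) *v y = 0)"

definition value_function ::
    "('a \<Rightarrow> real) \<Rightarrow> ('b::minus \<Rightarrow> ereal) \<Rightarrow> ('a \<Rightarrow> 'b) \<Rightarrow> 'b \<Rightarrow> ereal" where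
  "value_function f g c u = (INF x. ereal (f x) + g (c x - u))"

definition moreau_envelope :: "real \<Rightarrow> ('a::real_normed_vector \<Rightarrow> ereal) \<Rightarrow> 'a \<Rightarrow> ereal" where
  "moreau_envelope \<mu> g z = (INF w. g w + ereal (1 / (2 * \<mu>) * (norm (w - z))\<^sup>2))"

text \<open>Meaningful for proper lsc convex functions, where the minimizer exists and is unique.\<close>

definition prox :: "('a::real_normed_vector \<Rightarrow> ereal) \<Rightarrow> 'a \<Rightarrow> 'a" where
  "prox \<phi> z = (THE w. minimizer (\<lambda>w. \<phi> w + ereal (1 / 2 * (norm (w - z))\<^sup>2)) w)"

definition aug_lagrangian ::
    "('a \<Rightarrow> real) \<Rightarrow> ('b::real_normed_vector \<Rightarrow> ereal) \<Rightarrow> ('a \<Rightarrow> 'b) \<Rightarrow> real \<Rightarrow> 'a \<Rightarrow> 'b \<Rightarrow> ereal" where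
  "aug_lagrangian f g c \<mu> x y =
     ereal (f x) + moreau_envelope \<mu> g (c x + \<mu> *\<^sub>R y) - ereal (\<mu> / 2 * (norm y)\<^sup>2)"

text \<open>The sequences \<^term>\<open>x\<close>, \<^term>\<open>z\<close>, \<^term>\<open>y\<close> are a run of the classical augmented Lagrangian
  method with reduction bound \<^term>\<open>\<beta>\<close>, parameters \<^term>\<open>\<mu>\<close> and tolerances \<^term>\<open>\<epsilon>\<close>.
  The starting multiplier is \<^term>\<open>y 0\<close>.\<close>

definition classical_ALM ::
    "('a \<Rightarrow> real) \<Rightarrow> ('b::real_normed_vector \<Rightarrow> ereal) \<Rightarrow> ('a \<Rightarrow> 'b) \<Rightarrow> real \<Rightarrow>
     (nat \<Rightarrow> real) \<Rightarrow> (nat \<Rightarrow> real) \<Rightarrow> (nat \<Rightarrow> 'a) \<Rightarrow> (nat \<Rightarrow> 'b) \<Rightarrow> (nat \<Rightarrow> 'b) \<Rightarrow> bool" where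
  "classical_ALM f g c \<beta> \<mu> \<epsilon> x z y \<longleftrightarrow>
     \<beta> \<in> {0<..<1} \<and> \<mu> 0 > 0 \<and>
     (\<forall>k. \<epsilon> k \<ge> 0 \<and>
        aug_lagrangian f g c (\<mu> k) (x k) (y k)
          \<le> (INF x'. aug_lagrangian f g c (\<mu> k) x' (y k)) + ereal (\<epsilon> k) \<and>
        z k = prox (\<lambda>w. ereal (\<mu> k) * g w) (c (x k) + \<mu> k *\<^sub>R y k) \<and>
        y (Suc k) = y k + inverse (\<mu> k) *\<^sub>R (c (x k) - z k) \<and>
        (\<exists>b\<in>{0<..\<beta>} \<union> {1}. \<mu> (Suc k) = b * \<mu> k))"

end

theory Submission
  imports Defs
begin

text \<open>Minimizing the augmented Lagrangian over \<open>x\<close> amounts to minimizing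
  \<open>V u + u \<bullet> y + |u|\<^sup>2 / (2 \<mu>)\<close> over \<open>u\<close>, where \<open>V\<close> is the (convex) value function, so the method
  is an inexact proximal point iteration on the concave dual function
  \<open>y \<mapsto> inf\<^sub>u V u + u \<bullet> y\<close> with summable errors. The dual values increase up to a summable error and
  are bounded by \<open>V 0\<close>, which forces the primal residuals to zero. A bounded subsequence of
  multipliers would have a limit \<open>y\<close> with \<open>-y\<close> a subgradient of \<open>V\<close> at \<open>0\<close>, that is, a Lagrange multiplier for
  every minimizer, contradicting nonstationarity. Finally, comparison with \<open>u = 0\<close> gives
  \<open>f(x\<^sub>k) + g(z\<^sub>k) \<le> \<Phi>\<^sub>m\<^sub>i\<^sub>n + \<epsilon>\<^sub>k - \<mu>\<^sub>k/2 (|y\<^sub>k\<^sub>+\<^sub>1|\<^sup>2 - |y\<^sub>k|\<^sup>2)\<close>, and since \<open>|y\<^sub>k|\<close> tends to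
  infinity, the last term is nonpositive for infinitely many \<open>k\<close>.\<close>

section \<open>Minimizers and lower semicontinuous extended-real functions\<close>

lemma minimizer_iff: "minimizer h x \<longleftrightarrow> (\<forall>v. h x \<le> h v)"
  by (auto simp: minimizer_def is_arg_min_def not_less)

lemma lsc_funD:
  assumes "lsc_fun h" "(X \<longlongrightarrow> z) F" "a < h z"
  shows "eventually (\<lambda>n. a < h (X n)) F"
proof -
  have "eventually (\<lambda>w. a < h w) (nhds z)"
    using assms(1,3) unfolding lsc_fun_def le_Liminf_iff by blast
  then show ?thesis
    using assms(2) by (rule eventually_compose_filterlim)
qed

lemma lsc_fun_le_liminf:
  assumes "lsc_fun h" "X \<longlonglongrightarrow> z"
  shows "h z \<le> liminf (\<lambda>n. h (X n))"
  using lsc_funD[OF assms] by (auto simp: le_Liminf_iff)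

lemma lsc_fun_compose_continuous:
  fixes q :: "'a::topological_space \<Rightarrow> 'b::topological_space"
  assumes "lsc_fun h" "continuous_on UNIV q"
  shows "lsc_fun (\<lambda>w. h (q w))"
  unfolding lsc_fun_def le_Liminf_iff
proof (intro allI impI)
  fix z a assume "a < h (q z)"
  moreover have "(q \<longlongrightarrow> q z) (nhds z)"
    using assms(2) by (simp add: continuous_on_def tendsto_at_iff_tendsto_nhds)
  ultimately show "\<forall>\<^sub>F w in nhds z. a < h (q w)"
    using lsc_funD[OF assms(1)] by blast
qed

lemma lsc_fun_add_continuous:
  fixes h :: "'a::topological_space \<Rightarrow> ereal" and q :: "'a \<Rightarrow> real"
  assumes lsc: "lsc_fun h" and proper: "\<And>w. h w \<noteq> -\<infinity>" and q: "continuous_on UNIV q"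
  shows "lsc_fun (\<lambda>w. h w + ereal (q w))"
  unfolding lsc_fun_def le_Liminf_iff
proof (intro allI impI)
  fix z a assume a: "a < h z + ereal (q z)"
  have qz: "(q \<longlongrightarrow> q z) (nhds z)"
    using q by (simp add: continuous_on_def tendsto_at_iff_tendsto_nhds)
  show "\<forall>\<^sub>F w in nhds z. a < h w + ereal (q w)"
  proof (cases a)
    case (real r)
    have "ereal (r - q z) < h z"
      using a real by (cases "h z") auto
    \<comment> \<open>The number \<open>b\<close> shares the strict gap between the summands: near
      \<open>z\<close>, \<open>h\<close> stays above \<open>b\<close> and \<open>q\<close> above
      \<open>r - b\<close>.\<close>
    then obtain b where b: "r - q z < b" "ereal b < h z"
      using ereal_dense2 by force
    have "\<forall>\<^sub>F w in nhds z. ereal b < h w"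
      using lsc_funD[OF lsc filterlim_ident b(2)] .
    moreover have "\<forall>\<^sub>F w in nhds z. r - b < q w"
      using order_tendstoD(1)[OF qz, of "r - b"] b(1) by simp
    ultimately show ?thesis
    proof eventually_elim
      case (elim w)
      then show ?case using real by (cases "h w") auto
    qed
  next
    case MInf
    then show ?thesis using proper by (auto intro!: always_eventually)
  qed (use a in auto)
qed

text \<open>Direct method: a minimizing sequence in \<open>K\<close> has a convergent subsequence,
  and by lower semicontinuity the value at its limit is at most the infimum.\<close>

lemma lsc_fun_attains_inf:
  fixes h :: "'a::metric_space \<Rightarrow> ereal"
  assumes lsc: "lsc_fun h" and K: "compact K" "K \<noteq> {}"
  shows "\<exists>w\<in>K. \<forall>v\<in>K. h w \<le> h v"
proof -
  obtain s where s: "\<And>n. s n \<in> h ` K" "s \<longlonglongrightarrow> Inf (h ` K)"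
    using Inf_as_limit[of "h ` K"] K by auto
  then obtain X where X: "\<And>n. X n \<in> K" "\<And>n. s n = h (X n)"
    unfolding image_iff Bex_def by metis
  obtain w r where w: "w \<in> K" "strict_mono (r :: nat \<Rightarrow> nat)" "(X \<circ> r) \<longlonglongrightarrow> w"
    using K(1) X(1) unfolding compact_def by metis
  have "h w \<le> liminf (\<lambda>n. h ((X \<circ> r) n))"
    using lsc_fun_le_liminf[OF lsc w(3)] .
  also have "\<dots> = Inf (h ` K)"
    using LIMSEQ_subseq_LIMSEQ[OF s(2) w(2)] X(2)
    by (intro lim_imp_Liminf) (auto simp: o_def)
  finally show ?thesis
    using w(1) by (meson INF_lower order_trans)
qed

section \<open>Convex functions plus a quadratic, and the proximal map\<close>

text \<open>On the unit ball about \<open>w0\<close> the function has a finite minimum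
  \<open>m\<close>. For \<open>w\<close> outside, convexity on the segment from \<open>w0\<close> to
  \<open>w\<close>, evaluated where it leaves the ball, gives a bound linear in the distance, with
  slope \<open>A = r0 - m\<close>. This is what makes \<open>h\<close> plus a quadratic
  coercive.\<close>

lemma convex_lsc_linear_minorant:
  fixes h :: "'a::euclidean_space \<Rightarrow> ereal"
  assumes h: "proper_fun h" "lsc_fun h" "convex_fun h"
    and h0: "h w0 = ereal r0"
  shows "\<exists>A\<ge>0. \<forall>w. ereal (r0 - A - A * norm (w - w0)) \<le> h w"
proof -
  obtain p where p: "p \<in> cball w0 1" "\<And>v. v \<in> cball w0 1 \<Longrightarrow> h p \<le> h v"
    using lsc_fun_attains_inf[OF h(2), of "cball w0 1"] by auto
  have "h p \<le> h w0" "h p \<noteq> -\<infinity>"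
    using p(2)[of w0] h(1) by (auto simp: proper_fun_def)
  then obtain m where m: "h p = ereal m" "m \<le> r0"
    using h0 by (cases "h p") auto
  define A where "A = r0 - m"
  have "A \<ge> 0" using m by (simp add: A_def)
  have "ereal (r0 - A - A * norm (w - w0)) \<le> h w" for w
  proof (cases "norm (w - w0) \<le> 1")
    case True
    then have "ereal m \<le> h w"
      using p(2)[of w] m by (simp add: dist_norm norm_minus_commute)
    moreover have "r0 - A - A * norm (w - w0) \<le> m"
      using \<open>A \<ge> 0\<close> by (simp add: A_def)
    ultimately show ?thesis
      using ereal_less_eq(3) order_trans by blast
  next
    case False
    define t where "t = norm (w - w0)"
    have t: "t > 1" using False t_def by simp
    define v where "v = (1 - 1/t) *\<^sub>R w0 + (1/t) *\<^sub>R w"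
    have "v - w0 = (1/t) *\<^sub>R (w - w0)"
      by (simp add: v_def algebra_simps)
    then have "norm (v - w0) = 1"
      using t by (simp flip: t_def)
    then have "ereal m \<le> h v"
      using p(2)[of v] m by (simp add: dist_norm norm_minus_commute)
    also have "h v \<le> ereal (1 - 1/t) * h w0 + ereal (1/t) * h w"
      unfolding v_def using h(3)[unfolded convex_fun_def, rule_format, of "1 - 1/t" "1/t" w0 w] t
      by (simp add: field_simps)
    finally have *: "ereal m \<le> ereal (1 - 1/t) * h w0 + ereal (1/t) * h w" .
    show ?thesis
    proof (cases "h w")
      case (real r)
      have "m \<le> (1 - 1/t) * r0 + (1/t) * r" using * h0 real by simp
      then have "t * m \<le> t * ((1 - 1/t) * r0 + (1/t) * r)" using t by simp
      also have "\<dots> = (t - 1) * r0 + r" using t by (simp add: field_simps)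
      finally have "r0 - A * t \<le> r" by (simp add: A_def algebra_simps)
      then show ?thesis using real \<open>A \<ge> 0\<close> by (simp add: t_def)
    next
      case MInf
      then show ?thesis using h(1) by (simp add: proper_fun_def)
    qed simp
  qed
  with \<open>A \<ge> 0\<close> show ?thesis by blast
qed

text \<open>The quadratic outgrows the linear minorant of \<open>h\<close>, so outside a large ball
  no value is below the one at \<open>w0\<close>, and a minimizer over that ball is global.\<close>

lemma convex_lsc_plus_quadratic_minimizer:
  fixes h :: "'a::euclidean_space \<Rightarrow> ereal"
  assumes h: "proper_fun h" "lsc_fun h" "convex_fun h" and \<mu>: "\<mu> > 0"
  shows "\<exists>w. minimizer (\<lambda>w. h w + ereal (1 / (2 * \<mu>) * (norm (w - a))\<^sup>2)) w"
proof -
  define \<phi> where "\<phi> w = h w + ereal (1 / (2 * \<mu>) * (norm (w - a))\<^sup>2)" for w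
  have ninf: "h w \<noteq> -\<infinity>" for w
    using h(1) by (simp add: proper_fun_def)
  obtain w0 r0 where h0: "h w0 = ereal r0"
    using h(1) unfolding proper_fun_def effective_domain_def
    by (metis (mono_tags) empty_Collect_eq ereal_cases less_irrefl)
  obtain A where A: "A \<ge> 0" "\<And>w. ereal (r0 - A - A * norm (w - w0)) \<le> h w"
    using convex_lsc_linear_minorant[OF h h0] by blast
  define s where "s = norm (w0 - a)"
  \<comment> \<open>For \<open>t > R\<close> the summands \<open>2 * s + 4 * \<mu> * A\<close> give
    \<open>(t - s)\<^sup>2 \<ge> s\<^sup>2 + 4 * \<mu> * A * t\<close>, and the summand
    \<open>1\<close> gives \<open>A \<le> A * t\<close>. Together they absorb the loss
    \<open>A + A * t\<close> of the minorant.\<close>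
  define R where "R = 2 * s + 4 * \<mu> * A + 1"
  have s: "s \<ge> 0" by (simp add: s_def)
  have R: "R \<ge> 1" using s A(1) \<mu> by (simp add: R_def)
  have "lsc_fun \<phi>"
    unfolding \<phi>_def by (intro lsc_fun_add_continuous[OF h(2) ninf] continuous_intros)
  then obtain p where p: "p \<in> cball w0 R" "\<And>v. v \<in> cball w0 R \<Longrightarrow> \<phi> p \<le> \<phi> v"
    using lsc_fun_attains_inf[of \<phi> "cball w0 R"] R by auto
  have "\<phi> p \<le> \<phi> v" for v
  proof (cases "v \<in> cball w0 R")
    case False
    define t where "t = norm (v - w0)"
    have t: "t > R" using False by (simp add: t_def dist_norm norm_minus_commute)
    have "2 * s + 1 \<le> R"
      using A(1) \<mu> by (simp add: R_def)
    then have ts: "s \<le> t" using t s by linarith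
    have "t \<le> norm (v - a) + s"
      unfolding t_def s_def using norm_triangle_ineq4[of "v - a" "w0 - a"] by simp
    then have "(t - s)\<^sup>2 \<le> (norm (v - a))\<^sup>2"
      using ts by (intro power_mono) auto
    moreover have "s\<^sup>2 + 2 * \<mu> * (A + A * t) \<le> (t - s)\<^sup>2"
    proof -
      have "2 * \<mu> * A * 1 \<le> 2 * \<mu> * A * t" 
        using t R A(1) \<mu> by (intro mult_left_mono) auto
      moreover have "t * (2 * s + 4 * \<mu> * A) \<le> t * t"
        using t R by (intro mult_left_mono) (auto simp: R_def)
      ultimately show ?thesis
        by (simp add: power2_eq_square algebra_simps)
    qed
    ultimately have "s\<^sup>2 + 2 * \<mu> * (A + A * t) \<le> (norm (v - a))\<^sup>2" by simp
    then have "1 / (2 * \<mu>) * (s\<^sup>2 + 2 * \<mu> * (A + A * t)) \<le> 1 / (2 * \<mu>) * (norm (v - a))\<^sup>2"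
      using \<mu> by (intro mult_left_mono) auto
    then have "1 / (2 * \<mu>) * s\<^sup>2 + A + A * t \<le> 1 / (2 * \<mu>) * (norm (v - a))\<^sup>2"
      using \<mu> by (simp add: field_simps)
    then have "\<phi> w0 \<le> ereal (r0 - A - A * t) + ereal (1 / (2 * \<mu>) * (norm (v - a))\<^sup>2)"
      by (simp add: \<phi>_def h0 s_def)
    also have "\<dots> \<le> \<phi> v"
      unfolding \<phi>_def using A(2)[of v] by (intro add_mono) (auto simp: t_def)
    finally show ?thesis
      using p(2)[of w0] R by auto
  qed (use p in blast)
  then show ?thesis
    by (auto simp: minimizer_iff \<phi>_def)
qed

text \<open>First-order optimality: compare \<open>w\<close> with points of the segment towards
  \<open>v\<close>, bound \<open>h\<close> there by convexity, divide by the step \<open>t\<close>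
  and let \<open>t\<close> tend to 0, so that only the linear part of the quadratic
  survives.\<close>

lemma plus_quadratic_minimizer_subgradient:
  fixes h :: "'a::real_inner \<Rightarrow> ereal"
  assumes h: "proper_fun h" "convex_fun h" and \<mu>: "\<mu> > 0"
    and w: "minimizer (\<lambda>w. h w + ereal (1 / (2 * \<mu>) * (norm (w - a))\<^sup>2)) w"
  shows "inverse \<mu> *\<^sub>R (a - w) \<in> subdifferential h w"
proof -
  have min: "h w + ereal (1 / (2 * \<mu>) * (norm (w - a))\<^sup>2)
      \<le> h v + ereal (1 / (2 * \<mu>) * (norm (v - a))\<^sup>2)" for v
    using w by (simp add: minimizer_iff)
  have ninf: "h v \<noteq> -\<infinity>" for v
    using h(1) by (simp add: proper_fun_def)
  obtain v0 where "h v0 < \<infinity>"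
    using h(1) by (auto simp: proper_fun_def effective_domain_def)
  then have "h w \<noteq> \<infinity>"
    using min[of v0] by auto
  then obtain r where r: "h w = ereal r"
    using ninf by (cases "h w") auto
  have "h w + ereal (inverse \<mu> *\<^sub>R (a - w) \<bullet> (v - w)) \<le> h v" for v
  proof (cases "h v")
    case (real q)
    \<comment> \<open>\<open>t * N\<close> is the second-order remainder of the quadratic after
      division by \<open>t\<close>.\<close>
    define N where "N = (norm (v - w))\<^sup>2 / (2 * \<mu>)"
    have "r - q - inverse \<mu> * ((w - a) \<bullet> (v - w)) \<le> t * N" if t: "0 < t" "t \<le> 1" for t
    proof -
      define p where "p = (1 - t) *\<^sub>R w + t *\<^sub>R v"
      have pa: "p - a = (w - a) + t *\<^sub>R (v - w)"
        by (simp add: p_def algebra_simps)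
      have pn: "(norm (p - a))\<^sup>2 = (norm (w - a))\<^sup>2 + 2 * t * ((w - a) \<bullet> (v - w)) + t\<^sup>2 * (norm (v - w))\<^sup>2"
        unfolding pa power2_norm_eq_inner
        by (simp add: inner_add_left inner_add_right inner_commute power2_eq_square algebra_simps)
      have "h p \<le> ereal ((1 - t) * r + t * q)"
        unfolding p_def using h(2)[unfolded convex_fun_def, rule_format, of "1 - t" t w v] t r real
        by simp
      then have "r + 1 / (2 * \<mu>) * (norm (w - a))\<^sup>2
          \<le> (1 - t) * r + t * q + 1 / (2 * \<mu>) * (norm (p - a))\<^sup>2"
        using min[of p] r by (cases "h p") auto
      then have "t * (r - q) \<le> 1 / (2 * \<mu>) * ((norm (p - a))\<^sup>2 - (norm (w - a))\<^sup>2)"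
        by (simp add: algebra_simps)
      also have "\<dots> = t * (inverse \<mu> * ((w - a) \<bullet> (v - w)) + t * N)"
        unfolding pn N_def using \<mu> by (simp add: field_simps power2_eq_square)
      finally show ?thesis using t by simp
    qed
    moreover have "((\<lambda>t. t * N) \<longlongrightarrow> 0 * N) (at_right 0)"
      by (intro tendsto_intros)
    moreover have "\<forall>\<^sub>F t in at_right 0. 0 < t \<and> t \<le> (1::real)"
      using eventually_at_right_real[of 0 "1::real"] by (auto elim: eventually_mono)
    ultimately have "r - q - inverse \<mu> * ((w - a) \<bullet> (v - w)) \<le> 0 * N"
      by (intro tendsto_lowerbound[of "\<lambda>t. t * N" _ "at_right (0::real)"])
         (auto elim!: eventually_mono)
    then show ?thesis
      using r real by (simp add: inner_diff_left algebra_simps)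
  qed (use ninf in auto)
  then show ?thesis
    using r by (simp add: subdifferential_def effective_domain_def)
qed

text \<open>\<open>prox\<close> puts the weight \<mu> on the function, the Moreau envelope puts its
  inverse on the square; the two objectives differ by the positive factor \<mu>.\<close>

lemma minimizer_plus_quadratic_scale:
  fixes h :: "'a::real_normed_vector \<Rightarrow> ereal"
  assumes \<mu>: "\<mu> > 0"
  shows "minimizer (\<lambda>w. ereal \<mu> * h w + ereal (1 / 2 * (norm (w - a))\<^sup>2)) w
    \<longleftrightarrow> minimizer (\<lambda>w. h w + ereal (1 / (2 * \<mu>) * (norm (w - a))\<^sup>2)) w"
proof -
  have "ereal \<mu> * h w + ereal (1 / 2 * (norm (w - a))\<^sup>2)
      = ereal \<mu> * (h w + ereal (1 / (2 * \<mu>) * (norm (w - a))\<^sup>2))" for w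
    using \<mu> by (cases "h w") (auto simp: field_simps)
  then show ?thesis
    using \<mu> by (simp add: minimizer_iff ereal_mult_le_mult_iff)
qed

text \<open>Justifies the definite description in \<open>prox\<close>. Uniqueness: adding the
  subgradient inequalities of two minimizers \<open>v\<close> and \<open>w\<close>, each tested at
  the other, leaves \<open>(v - w) \<bullet> (v - w) \<le> 0\<close>.\<close>

lemma prox_scaled_minimizer:
  fixes h :: "'a::euclidean_space \<Rightarrow> ereal"
  assumes h: "proper_fun h" "lsc_fun h" "convex_fun h" and \<mu>: "\<mu> > 0"
  shows "minimizer (\<lambda>w. h w + ereal (1 / (2 * \<mu>) * (norm (w - a))\<^sup>2)) (prox (\<lambda>w. ereal \<mu> * h w) a)"
proof -
  let ?M = "minimizer (\<lambda>w. h w + ereal (1 / (2 * \<mu>) * (norm (w - a))\<^sup>2))"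
  obtain w where w: "?M w"
    using convex_lsc_plus_quadratic_minimizer[OF h \<mu>] by blast
  have "v = w" if v: "?M v" for v
  proof -
    have *: "h w + ereal ((inverse \<mu> *\<^sub>R (a - w)) \<bullet> (v - w)) \<le> h v" "w \<in> effective_domain h"
      "h v + ereal ((inverse \<mu> *\<^sub>R (a - v)) \<bullet> (w - v)) \<le> h w" "v \<in> effective_domain h"
      using plus_quadratic_minimizer_subgradient[OF h(1,3) \<mu> v]
        plus_quadratic_minimizer_subgradient[OF h(1,3) \<mu> w]
      by (simp_all only: subdifferential_def mem_Collect_eq)
    moreover obtain r q where "h w = ereal r" "h v = ereal q"
      using h(1) *(2,4) by (cases "h w"; cases "h v") (auto simp: effective_domain_def proper_fun_def)
    ultimately have "r + inverse \<mu> * ((a - w) \<bullet> (v - w)) \<le> q" "q + inverse \<mu> * ((a - v) \<bullet> (w - v)) \<le> r"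
      by simp_all
    then have "inverse \<mu> * ((a - w) \<bullet> (v - w) + (a - v) \<bullet> (w - v)) \<le> 0"
      by (simp add: distrib_left)
    then have "(a - w) \<bullet> (v - w) + (a - v) \<bullet> (w - v) \<le> 0"
      using \<mu> by (simp add: mult_le_0_iff)
    moreover have "(a - w) \<bullet> (v - w) + (a - v) \<bullet> (w - v) = (v - w) \<bullet> (v - w)"
      by (simp add: inner_diff_left inner_diff_right inner_commute)
    ultimately have "(v - w) \<bullet> (v - w) \<le> 0" by simp
    then have "(v - w) \<bullet> (v - w) = 0"
      using inner_ge_zero order_antisym by blast
    then show "v = w" by simp
  qed
  with w have "?M (THE w. ?M w)"
    by (intro theI[of ?M])
  then show ?thesis
    unfolding prox_def minimizer_plus_quadratic_scale[OF \<mu>] .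
qed

section \<open>The inexact proximal point iteration on the dual\<close>

text \<open>Here \<open>p\<close> is the exact regularized minimizer that \<open>u\<close>
  approximates. The subgradient at \<open>p\<close> together with the quadratic makes the
  regularized objective grow at least like \<open>(norm (u - p))\<^sup>2 / (2 * \<mu>)\<close> away
  from \<open>p\<close>, so the tolerance \<epsilon> controls the distance.\<close>

lemma dual_proximal_point_step:
  fixes V :: "'a::euclidean_space \<Rightarrow> ereal"
  assumes V: "proper_fun V" "lsc_fun V" "convex_fun V" and \<mu>: "\<mu> > 0"
    and u: "\<And>v. V u + ereal (u \<bullet> y + (norm u)\<^sup>2 / (2 * \<mu>))
      \<le> V v + ereal (v \<bullet> y + (norm v)\<^sup>2 / (2 * \<mu>)) + ereal \<epsilon>"
  shows "\<exists>p r. V p = ereal r \<and> (norm (u - p))\<^sup>2 \<le> 2 * \<mu> * \<epsilon> \<and>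
    (\<forall>v. ereal (r - (y + inverse \<mu> *\<^sub>R p) \<bullet> (v - p)) \<le> V v)"
proof -
  \<comment> \<open>Completing the square: a quadratic centred at \<open>a\<close> equals the
    regularization with linear term \<open>v \<bullet> y\<close>, up to a constant.\<close>
  define a where "a = - (\<mu> *\<^sub>R y)"
  obtain p where p: "minimizer (\<lambda>w. V w + ereal (1 / (2 * \<mu>) * (norm (w - a))\<^sup>2)) p"
    using convex_lsc_plus_quadratic_minimizer[OF V \<mu>] by blast
  have sub: "inverse \<mu> *\<^sub>R (a - p) \<in> subdifferential V p"
    using plus_quadratic_minimizer_subgradient[OF V(1,3) \<mu> p] .
  have eq: "inverse \<mu> *\<^sub>R (a - p) = - (y + inverse \<mu> *\<^sub>R p)"
    using \<mu> by (simp add: a_def algebra_simps)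
  have pd: "p \<in> effective_domain V"
    and ps: "\<And>v. V p + ereal (- (y + inverse \<mu> *\<^sub>R p) \<bullet> (v - p)) \<le> V v"
    using sub unfolding eq by (simp_all only: subdifferential_def mem_Collect_eq)
  obtain r where r: "V p = ereal r"
    using pd V(1) by (cases "V p") (auto simp: effective_domain_def proper_fun_def)
  have r_le: "ereal (r - (y + inverse \<mu> *\<^sub>R p) \<bullet> (v - p)) \<le> V v" for v
    using ps[of v] r by (simp only: inner_minus_left plus_ereal.simps(1) diff_conv_add_uminus)
  have "V u + ereal (u \<bullet> y + (norm u)\<^sup>2 / (2 * \<mu>))
      \<le> ereal (r + p \<bullet> y + (norm p)\<^sup>2 / (2 * \<mu>) + \<epsilon>)"
    using u[of p] r by (simp add: add.assoc)
  then obtain q where q: "V u = ereal q"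
    "q + u \<bullet> y + (norm u)\<^sup>2 / (2 * \<mu>) \<le> r + p \<bullet> y + (norm p)\<^sup>2 / (2 * \<mu>) + \<epsilon>"
    using V(1) by (cases "V u") (auto simp: proper_fun_def)
  have "r - (y + inverse \<mu> *\<^sub>R p) \<bullet> (u - p) \<le> q"
    using r_le[of u] q by simp
  with q(2) have "(norm u)\<^sup>2 / (2 * \<mu>) - (norm p)\<^sup>2 / (2 * \<mu>) - inverse \<mu> * (p \<bullet> (u - p)) \<le> \<epsilon>"
    by (simp add: inner_add_left inner_diff_right inner_commute[of y] right_diff_distrib)
  moreover have "(norm u)\<^sup>2 / (2 * \<mu>) - (norm p)\<^sup>2 / (2 * \<mu>) - inverse \<mu> * (p \<bullet> (u - p))
      = (norm (u - p))\<^sup>2 / (2 * \<mu>)"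
  proof -
    have "(norm u)\<^sup>2 = (norm (p + (u - p)))\<^sup>2" by simp
    also have "\<dots> = (norm p)\<^sup>2 + 2 * (p \<bullet> (u - p)) + (norm (u - p))\<^sup>2"
      unfolding power2_norm_eq_inner by (simp only: inner_add_left inner_add_right inner_commute[of "u - p" p])
    finally show ?thesis
      using \<mu> by (simp add: field_simps)
  qed
  ultimately have "(norm (u - p))\<^sup>2 / (2 * \<mu>) \<le> \<epsilon>" by simp
  then have "(norm (u - p))\<^sup>2 \<le> 2 * \<mu> * \<epsilon>"
    using \<mu> by (simp add: field_simps)
  with r r_le show ?thesis by blast
qed

text \<open>Separates the convergence argument from \<open>f\<close>, \<open>g\<close> and
  \<open>c\<close>: the iteration enters only through \<open>V\<close>, the perturbations
  \<open>u\<close> and the multipliers \<open>y\<close>. The assumption \<open>nosub\<close> encodes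
  the absence of Lagrange multipliers.\<close>

lemma inexact_dual_proximal_point:
  fixes V :: "'a::euclidean_space \<Rightarrow> ereal"
  assumes V: "proper_fun V" "lsc_fun V" "convex_fun V" and V0: "V 0 < \<infinity>"
    and \<mu>: "\<And>k. \<mu> k > 0" "\<And>k. \<mu> k \<le> M"
    and \<epsilon>: "\<And>k. \<epsilon> k \<ge> 0" "summable (\<lambda>k. \<epsilon> k / \<mu> k)"
    and y: "\<And>k. y (Suc k) = y k + inverse (\<mu> k) *\<^sub>R u k"
    and u: "\<And>k v. V (u k) + ereal (u k \<bullet> y k + (norm (u k))\<^sup>2 / (2 * \<mu> k))
      \<le> V v + ereal (v \<bullet> y k + (norm v)\<^sup>2 / (2 * \<mu> k)) + ereal (\<epsilon> k)"
    and nosub: "subdifferential V 0 = {}"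
  shows "u \<longlonglongrightarrow> 0" and "filterlim (\<lambda>k. norm (y k)) at_top sequentially"
proof -
  have "\<forall>k. \<exists>p r. V p = ereal r \<and> (norm (u k - p))\<^sup>2 \<le> 2 * \<mu> k * \<epsilon> k \<and>
      (\<forall>v. ereal (r - (y k + inverse (\<mu> k) *\<^sub>R p) \<bullet> (v - p)) \<le> V v)"
    using dual_proximal_point_step[OF V \<mu>(1) u] by blast
  then obtain p r where p: "\<And>k. V (p k) = ereal (r k)"
    and up: "\<And>k. (norm (u k - p k))\<^sup>2 \<le> 2 * \<mu> k * \<epsilon> k"
    and sub: "\<And>k v. ereal (r k - (y k + inverse (\<mu> k) *\<^sub>R p k) \<bullet> (v - p k)) \<le> V v"
    by metis
  \<comment> \<open>\<open>e k\<close> bounds the squared multiplier error: dividing the estimate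
    \<open>up\<close> by \<open>(\<mu> k)\<^sup>2\<close> leaves
    \<open>2 * (\<epsilon> k / \<mu> k)\<close>, which is summable.\<close>
  define e where "e k = 2 * (\<epsilon> k / \<mu> k)" for k
  have e: "e k \<ge> 0" for k
    using \<epsilon>(1)[of k] \<mu>(1)[of k] by (simp add: e_def)
  have sum_e: "summable e"
    unfolding e_def using \<epsilon>(2) by (rule summable_mult)
  have M: "M > 0" using \<mu>(1)[of 0] \<mu>(2)[of 0] by linarith
  \<comment> \<open>\<open>q k\<close> is the multiplier that exact minimization would produce in
    place of \<open>y (Suc k)\<close>; by \<open>sub\<close>, \<open>- q k\<close> is a subgradient
    of \<open>V\<close> at \<open>p k\<close>.\<close>
  define q where "q k = y k + inverse (\<mu> k) *\<^sub>R p k" for k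
  have yq: "(norm (y (Suc k) - q k))\<^sup>2 \<le> e k" for k
  proof -
    have "y (Suc k) - q k = inverse (\<mu> k) *\<^sub>R (u k - p k)"
      by (simp add: y q_def algebra_simps)
    then have "(norm (y (Suc k) - q k))\<^sup>2 = (norm (u k - p k))\<^sup>2 / (\<mu> k)\<^sup>2"
      using \<mu>(1)[of k] by (simp add: power_mult_distrib power_inverse divide_inverse mult.commute)
    also have "\<dots> \<le> 2 * \<mu> k * \<epsilon> k / (\<mu> k)\<^sup>2"
      using up[of k] by (intro divide_right_mono) auto
    also have "\<dots> = e k"
      using \<mu>(1)[of k] by (simp add: e_def power2_eq_square)
    finally show ?thesis .
  qed
  \<comment> \<open>\<open>D k\<close> is the value at \<open>q k\<close> of the dual function \<open>y \<mapsto> inf\<^sub>u V u + u \<bullet> y\<close>, whose supergradient there is \<open>p k\<close>\<close>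
  define D where "D k = r k + q k \<bullet> p k" for k
  obtain V0r where V0r: "V 0 = ereal V0r"
    using V0 V(1) by (cases "V 0") (auto simp: proper_fun_def)
  have D_le: "D k \<le> V0r" for k
    using sub[of k 0] V0r by (simp add: D_def q_def)
  \<comment> \<open>The subgradient at \<open>p k\<close>, tested at \<open>p (Suc k)\<close>,
    bounds the ascent below by \<open>(q (Suc k) - q k) \<bullet> p (Suc k)\<close>. This contains
    the square of \<open>p (Suc k)\<close> divided by \<open>\<mu> (Suc k)\<close>; Young's
    inequality spends half of it on the multiplier error \<open>?d\<close>.\<close>
  have D_step: "(norm (p (Suc k)))\<^sup>2 / (2 * M) \<le> D (Suc k) - D k + M / 2 * e k" for k
  proof -
    let ?m = "\<mu> (Suc k)" and ?p = "p (Suc k)" and ?d = "y (Suc k) - q k"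
    have "ereal (r k - q k \<bullet> (?p - p k)) \<le> ereal (r (Suc k))"
      using sub[of k ?p] p[of "Suc k"] by (simp add: q_def)
    then have "D k + (q (Suc k) - q k) \<bullet> ?p \<le> D (Suc k)"
      by (simp add: D_def algebra_simps)
    moreover have "(q (Suc k) - q k) \<bullet> ?p = inverse ?m * (norm ?p)\<^sup>2 + ?d \<bullet> ?p"
      by (simp add: q_def[of "Suc k"] power2_norm_eq_inner inner_add_left inner_diff_left)
    moreover have "- (?d \<bullet> ?p) \<le> inverse ?m / 2 * (norm ?p)\<^sup>2 + ?m / 2 * (norm ?d)\<^sup>2"
    proof -
      have "0 \<le> (norm (?m *\<^sub>R ?d + ?p))\<^sup>2" by simp
      also have "\<dots> = ?m\<^sup>2 * (norm ?d)\<^sup>2 + 2 * ?m * (?d \<bullet> ?p) + (norm ?p)\<^sup>2"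
        unfolding power2_norm_eq_inner
        by (simp add: inner_add_left inner_add_right inner_commute power2_eq_square)
      finally show ?thesis
        using \<mu>(1)[of "Suc k"] by (simp add: field_simps power2_eq_square)
    qed
    moreover have "?m / 2 * (norm ?d)\<^sup>2 \<le> M / 2 * e k"
      using \<mu>[of "Suc k"] yq[of k] by (intro mult_mono) (auto intro: order_trans less_imp_le)
    moreover have "(norm ?p)\<^sup>2 / (2 * M) \<le> inverse ?m / 2 * (norm ?p)\<^sup>2"
      using \<mu>[of "Suc k"] by (simp add: field_simps mult_right_mono)
    ultimately show ?thesis by (simp add: field_simps)
  qed
  \<comment> \<open>The increments of \<open>D\<close> telescope and \<open>D\<close> is bounded
    above by \<open>V 0\<close>.\<close>
  have "summable (\<lambda>k. (norm (p (Suc k)))\<^sup>2 / (2 * M))"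
  proof (rule summableI_nonneg_bounded)
    fix n
    have "(\<Sum>k<n. (norm (p (Suc k)))\<^sup>2 / (2 * M)) \<le> (\<Sum>k<n. D (Suc k) - D k) + (\<Sum>k<n. M / 2 * e k)"
      unfolding sum.distrib[symmetric] by (intro sum_mono D_step)
    also have "(\<Sum>k<n. D (Suc k) - D k) = D n - D 0"
      by (rule sum_lessThan_telescope)
    also have "(\<Sum>k<n. M / 2 * e k) \<le> (\<Sum>k. M / 2 * e k)"
      using sum_e e M by (intro sum_le_suminf summable_mult) auto
    finally show "(\<Sum>k<n. (norm (p (Suc k)))\<^sup>2 / (2 * M)) \<le> V0r - D 0 + (\<Sum>k. M / 2 * e k)"
      using D_le[of n] by simp
  qed (use M in auto)
  then have "(\<lambda>k. 2 * M * ((norm (p (Suc k)))\<^sup>2 / (2 * M))) \<longlonglongrightarrow> 2 * M * 0"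
    by (intro tendsto_intros summable_LIMSEQ_zero)
  then have "(\<lambda>k. (norm (p (Suc k)))\<^sup>2) \<longlonglongrightarrow> 0"
    using M by simp
  then have "(\<lambda>k. norm (p (Suc k))) \<longlonglongrightarrow> 0"
    using tendsto_real_sqrt by fastforce
  then have p0: "p \<longlonglongrightarrow> 0"
    using tendsto_norm_zero_cancel filterlim_sequentially_Suc by blast
  have e0: "e \<longlonglongrightarrow> 0"
    using sum_e by (rule summable_LIMSEQ_zero)
  have "(\<lambda>k. u k - p k) \<longlonglongrightarrow> 0"
  proof (rule Lim_null_comparison)
    have "norm (u k - p k) \<le> sqrt (M\<^sup>2 * e k)" for k
    proof (rule real_le_rsqrt)
      have "(norm (u k - p k))\<^sup>2 \<le> (\<mu> k)\<^sup>2 * e k"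
        using up[of k] \<mu>(1)[of k] by (simp add: e_def power2_eq_square)
      also have "\<dots> \<le> M\<^sup>2 * e k"
        using \<mu>[of k] e by (intro mult_right_mono power_mono) (auto intro: less_imp_le)
      finally show "(norm (u k - p k))\<^sup>2 \<le> M\<^sup>2 * e k" .
    qed
    then show "\<forall>\<^sub>F k in sequentially. norm (u k - p k) \<le> sqrt (M\<^sup>2 * e k)" by simp
    have "(\<lambda>k. sqrt (M\<^sup>2 * e k)) \<longlonglongrightarrow> sqrt (M\<^sup>2 * 0)"
      using e0 by (intro tendsto_intros)
    then show "(\<lambda>k. sqrt (M\<^sup>2 * e k)) \<longlonglongrightarrow> 0" by simp
  qed
  from tendsto_add[OF this p0] show "u \<longlonglongrightarrow> 0" by simp
  have yq0: "(\<lambda>k. y (Suc k) - q k) \<longlonglongrightarrow> 0"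
  proof (rule Lim_null_comparison)
    show "\<forall>\<^sub>F k in sequentially. norm (y (Suc k) - q k) \<le> sqrt (e k)"
      by (intro always_eventually allI real_le_rsqrt yq)
    show "(\<lambda>k. sqrt (e k)) \<longlonglongrightarrow> 0"
      using tendsto_real_sqrt[OF e0] by simp
  qed
  show "filterlim (\<lambda>k. norm (y k)) at_top sequentially"
  proof (rule ccontr)
    assume "\<not> ?thesis"
    \<comment> \<open>The shift aligns the indices: \<open>q k\<close> tracks
      \<open>y (Suc k)\<close>, not \<open>y k\<close>.\<close>
    then have "\<not> filterlim (\<lambda>k. norm (y (Suc k))) at_top sequentially"
      using filterlim_sequentially_Suc[of "\<lambda>k. norm (y k)"] by blast
    then obtain B where B: "\<not> (\<forall>\<^sub>F k in sequentially. B \<le> norm (y (Suc k)))"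
      unfolding filterlim_at_top by blast
    then have "\<exists>\<^sub>F k in sequentially. norm (y (Suc k)) < B"
      by (simp add: frequently_def not_less)
    then have "infinite {k. norm (y (Suc k)) < B}"
      by (simp add: frequently_cofinite flip: cofinite_eq_sequentially)
    then obtain s :: "nat \<Rightarrow> nat" where s: "strict_mono s" "\<And>k. norm (y (Suc (s k))) < B"
      using infinite_enumerate by (metis mem_Collect_eq)
    have "bounded (range (\<lambda>k. y (Suc (s k))))"
      using s(2) unfolding bounded_iff by (auto intro!: exI[of _ B] less_imp_le)
    then obtain ybar t where t: "strict_mono (t :: nat \<Rightarrow> nat)" "((\<lambda>k. y (Suc (s k))) \<circ> t) \<longlonglongrightarrow> ybar"
      using bounded_imp_convergent_subsequence by blast
    define j where "j = s \<circ> t"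
    have j: "strict_mono j"
      using s(1) t(1) by (simp add: j_def strict_mono_o)
    have yj: "(\<lambda>k. y (Suc (j k))) \<longlonglongrightarrow> ybar"
      using t(2) by (simp add: j_def o_def)
    have pj: "(\<lambda>k. p (j k)) \<longlonglongrightarrow> 0"
      using LIMSEQ_subseq_LIMSEQ[OF p0 j] by (simp add: o_def)
    have "(\<lambda>k. y (Suc (j k)) - q (j k)) \<longlonglongrightarrow> 0"
      using LIMSEQ_subseq_LIMSEQ[OF yq0 j] by (simp add: o_def)
    from tendsto_diff[OF yj this] have qj: "(\<lambda>k. q (j k)) \<longlonglongrightarrow> ybar" by simp
    \<comment> \<open>The subgradient inequality at \<open>p (j k)\<close> passes to the limit: its
      affine side converges, and lower semicontinuity of \<open>V\<close> at 0 controls the other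
      side.\<close>
    have "V 0 + ereal (- ybar \<bullet> (v - 0)) \<le> V v" for v
    proof (cases "V v")
      case (real a)
      have "V (p (j k)) \<le> ereal (a + q (j k) \<bullet> (v - p (j k)))" for k
        using sub[of "j k" v] real p[of "j k"] by (simp add: q_def)
      moreover have "(\<lambda>k. ereal (a + q (j k) \<bullet> (v - p (j k)))) \<longlonglongrightarrow> ereal (a + ybar \<bullet> (v - 0))"
        by (intro tendsto_intros qj pj)
      ultimately have "liminf (\<lambda>k. V (p (j k))) \<le> ereal (a + ybar \<bullet> (v - 0))"
        by (metis (no_types, lifting) Liminf_mono always_eventually lim_imp_Liminf trivial_limit_sequentially)
      with lsc_fun_le_liminf[OF V(2) pj] have "V 0 \<le> ereal (a + ybar \<bullet> (v - 0))"
        by (rule order_trans)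
      then show ?thesis
        using real V0r by (simp add: inner_minus_left)
    qed (use V(1) in \<open>auto simp: proper_fun_def\<close>)
    then have "- ybar \<in> subdifferential V 0"
      using V0 by (simp add: subdifferential_def effective_domain_def)
    with nosub show False by simp
  qed
qed

section \<open>Derivatives and the gradient\<close>

lemma continuously_differentiable_imp_differentiable:
  "continuously_differentiable h \<Longrightarrow> h differentiable (at x)"
  unfolding continuously_differentiable_def differentiable_def by blast

lemma continuously_differentiable_imp_continuous_on:
  "continuously_differentiable h \<Longrightarrow> continuous_on UNIV h"
  by (meson continuously_differentiable_imp_differentiable differentiable_at_imp_differentiable_on
      differentiable_imp_continuous_on)

text \<open>Since \<open>gradient\<close> is a definite description, existence and uniqueness are
  needed: the adjoint of the derivative applied to 1 represents it, and uniqueness of derivatives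
  identifies any two representing vectors.\<close>

lemma GDERIV_gradient:
  fixes f :: "'a::euclidean_space \<Rightarrow> real"
  assumes "f differentiable (at x)"
  shows "GDERIV f x :> gradient f x"
proof -
  obtain f' where f': "(f has_derivative f') (at x)"
    using assms by (auto simp: differentiable_def)
  have "h \<bullet> adjoint f' 1 = f' h" for h
    using adjoint_works[OF has_derivative_linear[OF f'], of h 1] by simp
  with f' have ex: "GDERIV f x :> adjoint f' 1"
    by (simp add: gderiv_def)
  have "d = e" if "GDERIV f x :> d" "GDERIV f x :> e" for d e
  proof -
    have "(\<lambda>h. h \<bullet> d) = (\<lambda>h. h \<bullet> e)"
      using that unfolding gderiv_def by (rule has_derivative_unique)
    then have "(d - e) \<bullet> d = (d - e) \<bullet> e" by metis
    then have "(d - e) \<bullet> (d - e) = 0" by (simp add: inner_diff_right)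
    then show ?thesis by simp
  qed
  with ex show ?thesis
    unfolding gradient_def by (intro theI[of "\<lambda>d. GDERIV f x :> d"])
qed

section \<open>The value function: convexity and subgradients at zero\<close>

lemma value_function_zero:
  fixes c :: "'a \<Rightarrow> 'b::real_vector"
  shows "value_function f g c 0 = (INF x. objective f g c x)"
  by (simp add: value_function_def objective_def)

text \<open>The perturbed objective \<open>?F\<close> is jointly convex, and minimizing it over
  \<open>x\<close> preserves convexity. Joint convexity holds because the deviation of
  \<open>c\<close> from affinity is a horizon direction, along which \<open>g\<close> does not
  increase.\<close>

lemma value_function_convex:
  fixes f :: "'a::real_vector \<Rightarrow> real" and g :: "'b::real_vector \<Rightarrow> ereal"
  assumes f: "convex_on UNIV f" and g: "proper_fun g" "convex_fun g"
    and c: "neg_cone_convex (horizon g) c" and V: "proper_fun (value_function f g c)"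
  shows "convex_fun (value_function f g c)"
  unfolding convex_fun_def
proof (intro allI impI)
  fix u w :: 'b and \<alpha> \<beta> :: real
  assume \<alpha>: "0 \<le> \<alpha>" and \<beta>: "0 \<le> \<beta>" and sum1: "\<alpha> + \<beta> = 1"
  then have \<beta>_eq: "\<beta> = 1 - \<alpha>" by simp
  let ?V = "value_function f g c"
  let ?F = "\<lambda>x u. ereal (f x) + g (c x - u)"
  \<comment> \<open>Real upper bounds \<open>A\<close> and \<open>B\<close> keep infinite values out
    of the arithmetic.\<close>
  have joint: "?F (\<alpha> *\<^sub>R x + \<beta> *\<^sub>R x') (\<alpha> *\<^sub>R u + \<beta> *\<^sub>R w) \<le> ereal (\<alpha> * A + \<beta> * B)"
    if x: "?F x u \<le> ereal A" "?F x' w \<le> ereal B" for x x' A B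
  proof -
    have ninf: "g (c x - u) \<noteq> -\<infinity>" "g (c x' - w) \<noteq> -\<infinity>"
      using g(1) by (simp_all add: proper_fun_def)
    obtain a where a: "g (c x - u) = ereal a" "f x + a \<le> A"
      using x(1) ninf(1) by (cases "g (c x - u)") auto
    obtain b where b: "g (c x' - w) = ereal b" "f x' + b \<le> B"
      using x(2) ninf(2) by (cases "g (c x' - w)") auto
    define s where "s = \<alpha> *\<^sub>R (c x - u) + \<beta> *\<^sub>R (c x' - w)"
    define v where "v = c (\<alpha> *\<^sub>R x + \<beta> *\<^sub>R x') - \<alpha> *\<^sub>R c x - \<beta> *\<^sub>R c x'"
    have v: "v \<in> horizon g"
      using c[unfolded neg_cone_convex_def, rule_format, of \<alpha> x x'] \<alpha> \<beta>
      by (simp add: v_def \<beta>_eq)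
    have s: "g s \<le> ereal (\<alpha> * a + \<beta> * b)"
      unfolding s_def using g(2)[unfolded convex_fun_def, rule_format, OF \<alpha> \<beta> sum1, of "c x - u" "c x' - w"] a b
      by simp
    then have "s \<in> effective_domain g"
      by (auto simp: effective_domain_def)
    with v s have "g (s + v) \<le> ereal (\<alpha> * a + \<beta> * b)"
      unfolding horizon_def by fastforce
    moreover have "s + v = c (\<alpha> *\<^sub>R x + \<beta> *\<^sub>R x') - (\<alpha> *\<^sub>R u + \<beta> *\<^sub>R w)"
      by (simp add: s_def v_def algebra_simps)
    moreover have "f (\<alpha> *\<^sub>R x + \<beta> *\<^sub>R x') \<le> \<alpha> * f x + \<beta> * f x'"
      using convex_onD[OF f, of \<beta> x x'] \<alpha> \<beta> by (simp add: \<beta>_eq)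
    ultimately have "?F (\<alpha> *\<^sub>R x + \<beta> *\<^sub>R x') (\<alpha> *\<^sub>R u + \<beta> *\<^sub>R w)
        \<le> ereal (\<alpha> * f x + \<beta> * f x') + ereal (\<alpha> * a + \<beta> * b)"
      by (intro add_mono) simp_all
    also have "\<dots> = ereal (\<alpha> * (f x + a) + \<beta> * (f x' + b))"
      by (simp add: algebra_simps)
    also have "\<dots> \<le> ereal (\<alpha> * A + \<beta> * B)"
      using a b \<alpha> \<beta> by (simp add: add_mono mult_left_mono)
    finally show ?thesis .
  qed
  have ninf: "?V u \<noteq> -\<infinity>" "?V w \<noteq> -\<infinity>"
    using V by (simp_all add: proper_fun_def)
  show "?V (\<alpha> *\<^sub>R u + \<beta> *\<^sub>R w) \<le> ereal \<alpha> * ?V u + ereal \<beta> * ?V w"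
  \<comment> \<open>With a zero weight, zero times infinity is zero and both sides agree. With
    positive weights an infinite value makes the right side infinite.\<close>
  proof (cases "\<alpha> = 0 \<or> \<beta> = 0")
    case True
    then show ?thesis using sum1 by (auto simp flip: zero_ereal_def)
  next
    case False
    then have pos: "\<alpha> > 0" "\<beta> > 0" using \<alpha> \<beta> by linarith+
    show ?thesis
    proof (cases "?V u = \<infinity> \<or> ?V w = \<infinity>")
      case True
      then have *: "ereal \<alpha> * ?V u + ereal \<beta> * ?V w = \<infinity>"
        using ninf pos by (cases "?V u"; cases "?V w") simp_all
      show ?thesis unfolding * by simp
    next
      case False
      then obtain a b where ab: "?V u = ereal a" "?V w = ereal b"
        using ninf by (meson ereal_cases)
      \<comment> \<open>The infima defining \<open>?V\<close> need not be attained, hence points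
        that are optimal up to \<open>e\<close>.\<close>
      have "?V (\<alpha> *\<^sub>R u + \<beta> *\<^sub>R w) \<le> ereal (\<alpha> * a + \<beta> * b) + ereal e" if e: "e > 0" for e
      proof -
        have "?V u < ereal (a + e)" "?V w < ereal (b + e)"
          using ab e by simp_all
        then obtain x x' where "?F x u < ereal (a + e)" "?F x' w < ereal (b + e)"
          unfolding value_function_def INF_less_iff by blast
        from joint[OF less_imp_le[OF this(1)] less_imp_le[OF this(2)]]
        have "?V (\<alpha> *\<^sub>R u + \<beta> *\<^sub>R w) \<le> ereal (\<alpha> * (a + e) + \<beta> * (b + e))"
          unfolding value_function_def by (rule INF_lower2[OF UNIV_I])
        moreover have "\<alpha> * (a + e) + \<beta> * (b + e) = \<alpha> * a + \<beta> * b + (\<alpha> + \<beta>) * e"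
          by (simp add: algebra_simps)
        ultimately show ?thesis using sum1 by simp
      qed
      then have "?V (\<alpha> *\<^sub>R u + \<beta> *\<^sub>R w) \<le> ereal (\<alpha> * a + \<beta> * b)"
        by (rule ereal_le_epsilon2)
      then show ?thesis
        using ab by simp
    qed
  qed
qed

text \<open>The vector \<open>- l\<close> serves as multiplier: the subgradient inequality gives the
  bound \<open>key\<close>, joint in \<open>x\<close> and \<open>u\<close>, and two specializations
  of it yield the two parts of stationarity.\<close>

lemma value_function_subgradient_imp_stationary:
  fixes f :: "real^'n \<Rightarrow> real" and g :: "real^'m \<Rightarrow> ereal" and c :: "real^'n \<Rightarrow> real^'m"
  assumes f: "f differentiable (at xbar)" and c: "c differentiable (at xbar)"
    and g: "proper_fun g" and xbar: "feasible g c xbar" "minimizer (objective f g c) xbar"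
    and l: "l \<in> subdifferential (value_function f g c) 0"
  shows "stationary f g c xbar"
proof -
  obtain G where G: "g (c xbar) = ereal G"
    using xbar(1) g by (cases "g (c xbar)") (auto simp: feasible_def effective_domain_def proper_fun_def)
  have "value_function f g c 0 = objective f g c xbar"
    unfolding value_function_zero using xbar(2)
    by (intro antisym INF_lower INF_greatest) (auto simp: minimizer_iff)
  then have V0: "value_function f g c 0 = ereal (f xbar + G)"
    by (simp add: objective_def G)
  have key: "ereal (f xbar + G + l \<bullet> u) \<le> ereal (f x) + g (c x - u)" for x u
  proof -
    have "ereal (f xbar + G + l \<bullet> u) \<le> value_function f g c u"
      using l V0 by (auto simp: subdifferential_def)
    also have "\<dots> \<le> ereal (f x) + g (c x - u)"
      unfolding value_function_def by (rule INF_lower) simp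
    finally show ?thesis .
  qed
  \<comment> \<open>Freezing \<open>x\<close> at \<open>xbar\<close> leaves an inequality about
    \<open>g\<close> alone.\<close>
  have "g (c xbar) + ereal (- l \<bullet> (w - c xbar)) \<le> g w" for w
    using key[of "c xbar - w" xbar] G
    by (cases "g w") (auto simp: inner_diff_right)
  then have sub: "- l \<in> subdifferential g (c xbar)"
    using xbar(1) by (simp add: subdifferential_def feasible_def)
  \<comment> \<open>The choice of \<open>u\<close> keeps the argument of \<open>g\<close> at
    \<open>c xbar\<close>, so \<open>xbar\<close> minimizes a differentiable function and Fermat's
    rule applies.\<close>
  have min: "f xbar - l \<bullet> c xbar \<le> f x - l \<bullet> c x" for x
    using key[of "c x - c xbar" x] G by (simp add: inner_diff_right)
  have fd: "(f has_derivative (\<lambda>h. h \<bullet> gradient f xbar)) (at xbar)"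
    using GDERIV_gradient[OF f] by (simp add: gderiv_def)
  have cd: "(c has_derivative (\<lambda>h. jacobian c (at xbar) *v h)) (at xbar)"
    using c jacobian_works by blast
  have "((\<lambda>x. f x - l \<bullet> c x) has_derivative (\<lambda>h. h \<bullet> gradient f xbar - l \<bullet> (jacobian c (at xbar) *v h))) (at xbar)"
    by (intro has_derivative_diff fd has_derivative_inner_right cd)
  then have "(\<lambda>h. h \<bullet> gradient f xbar - l \<bullet> (jacobian c (at xbar) *v h)) = (\<lambda>h. 0)"
    by (rule differential_zero_maxmin[OF UNIV_I open_UNIV]) (use min in blast)
  then have "h \<bullet> gradient f xbar - l \<bullet> (jacobian c (at xbar) *v h) = 0" for h
    by metis
  then have "h \<bullet> (gradient f xbar + transpose (jacobian c (at xbar)) *v (- l)) = 0" for h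
    by (simp add: inner_add_right inner_commute[of h "_ v* _"] dot_lmul_matrix)
  then have "gradient f xbar + transpose (jacobian c (at xbar)) *v (- l) = 0"
    using inner_eq_zero_iff by blast
  with sub xbar(1) show ?thesis
    unfolding stationary_def by blast
qed

section \<open>The augmented Lagrangian in terms of perturbations\<close>

text \<open>Expanding the square produces \<open>\<mu> / 2 * (norm y)\<^sup>2\<close>, which the
  last term cancels. What remains depends on \<open>w\<close> beyond \<open>gw\<close> only through
  the perturbation \<open>cx - w\<close>.\<close>

lemma aug_lagrangian_term:
  fixes w y cx :: "'b::real_inner"
  assumes "\<mu> > 0"
  shows "ereal fx + (gw + ereal (1 / (2 * \<mu>) * (norm (w - (cx + \<mu> *\<^sub>R y)))\<^sup>2)) - ereal (\<mu> / 2 * (norm y)\<^sup>2)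
    = ereal fx + gw + ereal ((cx - w) \<bullet> y + (norm (cx - w))\<^sup>2 / (2 * \<mu>))"
proof -
  define u where "u = cx - w"
  have "w - (cx + \<mu> *\<^sub>R y) = - (u + \<mu> *\<^sub>R y)"
    by (simp add: u_def)
  then have "norm (w - (cx + \<mu> *\<^sub>R y)) = norm (u + \<mu> *\<^sub>R y)"
    by (simp only: norm_minus_cancel)
  then have "(norm (w - (cx + \<mu> *\<^sub>R y)))\<^sup>2 = (norm (u + \<mu> *\<^sub>R y))\<^sup>2" by simp
  also have "\<dots> = (norm u)\<^sup>2 + 2 * \<mu> * (u \<bullet> y) + \<mu>\<^sup>2 * (norm y)\<^sup>2"
    unfolding power2_norm_eq_inner
    by (simp add: inner_add_left inner_add_right inner_commute power2_eq_square)
  finally have "1 / (2 * \<mu>) * (norm (w - (cx + \<mu> *\<^sub>R y)))\<^sup>2 = u \<bullet> y + (norm u)\<^sup>2 / (2 * \<mu>) + \<mu> / 2 * (norm y)\<^sup>2"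
    using assms by (simp add: field_simps power2_eq_square)
  then show ?thesis
    by (cases gw) (auto simp: u_def)
qed

lemma aug_lagrangian_le:
  fixes g :: "'b::real_inner \<Rightarrow> ereal"
  assumes "\<mu> > 0"
  shows "aug_lagrangian f g c \<mu> x y \<le> ereal (f x) + g w + ereal ((c x - w) \<bullet> y + (norm (c x - w))\<^sup>2 / (2 * \<mu>))"
proof -
  have "aug_lagrangian f g c \<mu> x y
    \<le> ereal (f x) + (g w + ereal (1 / (2 * \<mu>) * (norm (w - (c x + \<mu> *\<^sub>R y)))\<^sup>2)) - ereal (\<mu> / 2 * (norm y)\<^sup>2)"
    unfolding aug_lagrangian_def moreau_envelope_def
    by (intro ereal_minus_mono add_mono INF_lower order_refl) simp_all
  then show ?thesis
    unfolding aug_lagrangian_term[OF assms] .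
qed

text \<open>The infimum in the Moreau envelope is attained at the proximal point.\<close>

lemma aug_lagrangian_prox:
  fixes g :: "'b::euclidean_space \<Rightarrow> ereal"
  assumes g: "proper_fun g" "lsc_fun g" "convex_fun g" and \<mu>: "\<mu> > 0"
    and z: "z = prox (\<lambda>w. ereal \<mu> * g w) (c x + \<mu> *\<^sub>R y)"
  shows "aug_lagrangian f g c \<mu> x y = ereal (f x) + g z + ereal ((c x - z) \<bullet> y + (norm (c x - z))\<^sup>2 / (2 * \<mu>))"
    and "g z < \<infinity>"
proof -
  have min: "minimizer (\<lambda>w. g w + ereal (1 / (2 * \<mu>) * (norm (w - (c x + \<mu> *\<^sub>R y)))\<^sup>2)) z"
    unfolding z by (rule prox_scaled_minimizer[OF g \<mu>])
  then have "moreau_envelope \<mu> g (c x + \<mu> *\<^sub>R y) = g z + ereal (1 / (2 * \<mu>) * (norm (z - (c x + \<mu> *\<^sub>R y)))\<^sup>2)"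
    unfolding moreau_envelope_def minimizer_iff by (intro antisym INF_lower INF_greatest) auto
  then show "aug_lagrangian f g c \<mu> x y = ereal (f x) + g z + ereal ((c x - z) \<bullet> y + (norm (c x - z))\<^sup>2 / (2 * \<mu>))"
    unfolding aug_lagrangian_def by (simp only: aug_lagrangian_term[OF \<mu>])
  show "g z < \<infinity>"
    using plus_quadratic_minimizer_subgradient[OF g(1,3) \<mu> min]
    by (simp add: subdifferential_def effective_domain_def)
qed

section \<open>Two facts on sequences\<close>

text \<open>Terms eventually lie below 1, where squaring only shrinks them. Used to pass from square
  roots of \<open>\<epsilon> k / \<mu> k\<close> to the quotients themselves.\<close>

lemma summable_power2_of_summable:
  fixes a :: "nat \<Rightarrow> real"
  assumes "summable a" "\<And>k. a k \<ge> 0"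
  shows "summable (\<lambda>k. (a k)\<^sup>2)"
proof (rule summable_comparison_test_ev[OF _ assms(1)])
  have "\<forall>\<^sub>F k in sequentially. a k < 1"
    using summable_LIMSEQ_zero[OF assms(1)] by (rule order_tendstoD) simp
  then show "\<forall>\<^sub>F k in sequentially. norm ((a k)\<^sup>2) \<le> a k"
  proof eventually_elim
    case (elim k)
    then show ?case
      using assms(2)[of k] by (simp add: power2_eq_square mult_left_le)
  qed
qed

text \<open>Otherwise the sequence would decrease from some index on and stay bounded above.\<close>

lemma filterlim_at_top_infinite_ascents:
  fixes a :: "nat \<Rightarrow> 'a::{unbounded_dense_linorder}"
  assumes "filterlim a at_top sequentially"
  shows "infinite {k. a k \<le> a (Suc k)}"
proof
  assume "finite {k. a k \<le> a (Suc k)}"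
  then obtain N where N: "\<And>k. a k \<le> a (Suc k) \<Longrightarrow> k < N"
    using finite_nat_set_iff_bounded by auto
  have le: "a k \<le> a N" if "k \<ge> N" for k
    using that
  proof (induction k rule: dec_induct)
    case (step k)
    then have "a (Suc k) < a k" using N[of k] by force
    with step show ?case by simp
  qed simp
  have "\<forall>\<^sub>F k in sequentially. a N < a k"
    using assms by (simp add: filterlim_at_top_dense)
  then obtain k where "k \<ge> N" "a N < a k"
    by (metis eventually_at_top_linorder nle_le)
  with le show False by (simp add: leD)
qed

section \<open>Convergence of the augmented Lagrangian iterates\<close>

theorem theorem4p7:
  fixes f :: "real^'n \<Rightarrow> real"
    and g :: "real^'m \<Rightarrow> ereal"
    and c :: "real^'n \<Rightarrow> real^'m"
    and \<beta> :: real
    and \<mu> \<epsilon> :: "nat \<Rightarrow> real"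
    and x :: "nat \<Rightarrow> real^'n"
    and z y :: "nat \<Rightarrow> real^'m"
    and \<Phi>_min :: ereal
  assumes f: "continuously_differentiable f" "convex_on UNIV f"
    and g: "proper_fun g" "lsc_fun g" "convex_fun g"
    and c: "continuously_differentiable c" "neg_cone_convex (horizon g) c"
    and feas: "\<exists>x. feasible g c x"
    and min_ex: "\<exists>x. minimizer (objective f g c) x"
    and \<Phi>_min: "\<Phi>_min = (INF x. objective f g c x)"
    and nonstat: "\<forall>x. minimizer (objective f g c) x \<longrightarrow> \<not> stationary f g c x"
    and V: "proper_fun (value_function f g c)" "lsc_fun (value_function f g c)"
    and alm: "classical_ALM f g c \<beta> \<mu> \<epsilon> x z y"
    and summ: "summable (\<lambda>k. sqrt (\<epsilon> k / \<mu> k))"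
  shows "(\<lambda>k. c (x k) - z k) \<longlonglongrightarrow> 0 \<and>
    filterlim (\<lambda>k. norm (y k)) at_top sequentially \<and>
    liminf (\<lambda>k. ereal (f (x k)) + g (z k)) \<le> \<Phi>_min \<and>
    (bounded (range x) \<longrightarrow>
      (\<exists>xbar (r :: nat \<Rightarrow> nat). strict_mono r \<and>
        (\<lambda>k. x (r k)) \<longlonglongrightarrow> xbar \<and>
        minimizer (objective f g c) xbar \<and>
        (\<lambda>k. z (r k)) \<longlonglongrightarrow> c xbar \<and>
        (\<lambda>k. ereal (f (x (r k))) + g (z (r k))) \<longlonglongrightarrow> \<Phi>_min))"
proof -
  let ?V = "value_function f g c"
  \<comment> \<open>The iterate \<open>x k\<close> is seen as a trial point for the perturbation
    \<open>u k\<close>, since \<open>c (x k) - u k = z k\<close>.\<close>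
  define u where "u k = c (x k) - z k" for k
  define q where "q k v = v \<bullet> y k + (norm v)\<^sup>2 / (2 * \<mu> k)" for k v
  have eps: "\<epsilon> k \<ge> 0"
    and approx: "aug_lagrangian f g c (\<mu> k) (x k) (y k)
      \<le> (INF x'. aug_lagrangian f g c (\<mu> k) x' (y k)) + ereal (\<epsilon> k)"
    and z: "z k = prox (\<lambda>w. ereal (\<mu> k) * g w) (c (x k) + \<mu> k *\<^sub>R y k)"
    and y: "y (Suc k) = y k + inverse (\<mu> k) *\<^sub>R u k"
    and b: "\<exists>b\<in>{0<..\<beta>} \<union> {1}. \<mu> (Suc k) = b * \<mu> k" for k
    using alm by (auto simp: classical_ALM_def u_def)
  have \<beta>: "\<beta> < 1" and \<mu>0: "\<mu> 0 > 0"
    using alm by (auto simp: classical_ALM_def)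
  have "0 < \<mu> k \<and> \<mu> k \<le> \<mu> 0" for k
  proof (induction k)
    case (Suc k)
    obtain t where "t \<in> {0<..\<beta>} \<union> {1}" and t: "\<mu> (Suc k) = t * \<mu> k"
      using b[of k] by blast
    then have "0 < t" "t \<le> 1"
      using \<beta> by auto
    then have "0 < \<mu> (Suc k)" "\<mu> (Suc k) \<le> \<mu> k"
      unfolding t using Suc by (auto intro: mult_left_le_one_le)
    with Suc show ?case by linarith
  qed (simp add: \<mu>0)
  then have \<mu>: "\<mu> k > 0" "\<mu> k \<le> \<mu> 0" for k by blast+
  have \<Phi>_V: "?V 0 = \<Phi>_min"
    by (simp add: value_function_zero \<Phi>_min)
  have "\<Phi>_min < \<infinity>"
    using feas unfolding \<Phi>_min INF_less_iff
    by (auto simp: objective_def feasible_def effective_domain_def)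
  then obtain \<Phi> where \<Phi>: "\<Phi>_min = ereal \<Phi>"
    using V(1) \<Phi>_V by (cases \<Phi>_min) (auto simp: proper_fun_def)
  have lagr: "aug_lagrangian f g c (\<mu> k) (x k) (y k) = ereal (f (x k)) + g (z k) + ereal (q k (u k))"
      "g (z k) < \<infinity>" for k
    using aug_lagrangian_prox[OF g \<mu>(1), of "z k" k c "x k" "y k"] z[of k] by (simp_all add: q_def u_def)
  have "\<exists>G. g (z k) = ereal G" for k
    using lagr(2)[of k] g(1) by (cases "g (z k)") (auto simp: proper_fun_def)
  then obtain G where G: "\<And>k. g (z k) = ereal (G k)"
    by metis
  define F where "F k = f (x k) + G k" for k
  have V_u: "?V (u k) \<le> ereal (F k)" for k
  proof -
    have "?V (u k) \<le> ereal (f (x k)) + g (c (x k) - u k)"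
      unfolding value_function_def by (rule INF_lower) simp
    then show ?thesis by (simp add: u_def G F_def)
  qed
  \<comment> \<open>Bounding the envelope at \<open>x'\<close> by the candidate
    \<open>c x' - v\<close> turns the approximate minimality of \<open>x k\<close> over
    \<open>x'\<close> into one against every perturbation \<open>v\<close>.\<close>
  have F_le: "ereal (F k + q k (u k)) \<le> ?V v + ereal (q k v) + ereal (\<epsilon> k)" for k v
  proof -
    have "ereal (F k + q k (u k) - q k v - \<epsilon> k) \<le> ereal (f x') + g (c x' - v)" for x'
    proof -
      have "ereal (F k + q k (u k)) = aug_lagrangian f g c (\<mu> k) (x k) (y k)"
        unfolding lagr(1) by (simp add: F_def G)
      also have "\<dots> \<le> aug_lagrangian f g c (\<mu> k) x' (y k) + ereal (\<epsilon> k)"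
        using approx[of k] by (rule order_trans) (intro add_mono INF_lower order_refl UNIV_I)
      also have "\<dots> \<le> ereal (f x') + g (c x' - v) + ereal (q k v) + ereal (\<epsilon> k)"
        using aug_lagrangian_le[OF \<mu>(1)[of k], of f g c x' "y k" "c x' - v"]
        by (intro add_mono order_refl) (simp add: q_def)
      finally show ?thesis
        by (cases "g (c x' - v)") auto
    qed
    then have "ereal (F k + q k (u k) - q k v - \<epsilon> k) \<le> ?V v"
      unfolding value_function_def by (intro INF_greatest)
    then show ?thesis
      by (cases "?V v") auto
  qed
  obtain xmin where xmin: "minimizer (objective f g c) xmin"
    using min_ex by blast
  have obj_min: "objective f g c xmin = \<Phi>_min"
    using xmin unfolding \<Phi>_min minimizer_iff by (intro antisym INF_lower INF_greatest) auto
  then have "feasible g c xmin"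
    using \<Phi> by (cases "g (c xmin)") (auto simp: objective_def feasible_def effective_domain_def)
  then have nosub: "subdifferential ?V 0 = {}"
    using value_function_subgradient_imp_stationary[OF
        continuously_differentiable_imp_differentiable[OF f(1)]
        continuously_differentiable_imp_differentiable[OF c(1)] g(1) _ xmin] xmin nonstat
    by blast
  have "0 \<le> sqrt (\<epsilon> k / \<mu> k)" "(sqrt (\<epsilon> k / \<mu> k))\<^sup>2 = \<epsilon> k / \<mu> k" for k
    using eps[of k] \<mu>(1)[of k] by simp_all
  with summable_power2_of_summable[OF summ] have sum_eps: "summable (\<lambda>k. \<epsilon> k / \<mu> k)"
    by simp
  have step: "?V (u k) + ereal (u k \<bullet> y k + (norm (u k))\<^sup>2 / (2 * \<mu> k))
      \<le> ?V v + ereal (v \<bullet> y k + (norm v)\<^sup>2 / (2 * \<mu> k)) + ereal (\<epsilon> k)" for k v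
  proof -
    have "?V (u k) + ereal (q k (u k)) \<le> ereal (F k) + ereal (q k (u k))"
      using V_u by (intro add_mono order_refl)
    also have "\<dots> \<le> ?V v + ereal (q k v) + ereal (\<epsilon> k)"
      using F_le by simp
    finally show ?thesis by (simp add: q_def)
  qed
  have V_conv: "convex_fun ?V"
    by (rule value_function_convex[OF f(2) g(1,3) c(2) V(1)])
  have V0: "?V 0 < \<infinity>"
    by (simp add: \<Phi>_V \<Phi>)
  note ppa = inexact_dual_proximal_point[OF V V_conv V0 \<mu> eps sum_eps y step nosub]
  \<comment> \<open>The multiplier update gives \<open>(norm (y (Suc k)))\<^sup>2 - (norm (y
    k))\<^sup>2 = 2 / \<mu> k * q k (u k)\<close>, so a growing norm makes the regularization term
    nonnegative; it can then be dropped from \<open>F_le\<close> with \<open>v = 0\<close>.\<close>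
  have F_le_\<Phi>: "F k \<le> \<Phi> + \<epsilon> k" if "norm (y k) \<le> norm (y (Suc k))" for k
  proof -
    have "(norm (y (Suc k)))\<^sup>2 = (norm (y k))\<^sup>2 + 2 / \<mu> k * q k (u k)"
      using \<mu>(1)[of k] unfolding y q_def power2_norm_eq_inner
      by (simp add: inner_add_left inner_add_right inner_commute field_simps power2_eq_square)
    moreover have "(norm (y k))\<^sup>2 \<le> (norm (y (Suc k)))\<^sup>2"
      using that by (intro power_mono) auto
    ultimately have "0 \<le> q k (u k)"
      using \<mu>(1)[of k] by (simp add: zero_le_divide_iff)
    moreover have "F k + q k (u k) \<le> \<Phi> + \<epsilon> k"
      using F_le[of k 0] by (simp add: q_def \<Phi>_V \<Phi>)
    ultimately show ?thesis by simp
  qed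
  obtain s :: "nat \<Rightarrow> nat" where s: "strict_mono s" "\<And>k. norm (y (s k)) \<le> norm (y (Suc (s k)))"
    using infinite_enumerate[OF filterlim_at_top_infinite_ascents[OF ppa(2)]] by auto
  \<comment> \<open>The tolerance is \<mu> times a summable quotient, and \<mu> never exceeds
    \<open>\<mu> 0\<close>.\<close>
  have "\<epsilon> \<longlonglongrightarrow> 0"
  proof (rule Lim_null_comparison)
    have "norm (\<epsilon> k) \<le> \<mu> 0 * (\<epsilon> k / \<mu> k)" for k
      using \<mu>[of k] eps[of k] by (simp add: field_simps mult_left_mono)
    then show "\<forall>\<^sub>F k in sequentially. norm (\<epsilon> k) \<le> \<mu> 0 * (\<epsilon> k / \<mu> k)" by simp
    show "(\<lambda>k. \<mu> 0 * (\<epsilon> k / \<mu> k)) \<longlonglongrightarrow> 0"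
      using tendsto_mult_right_zero[OF summable_LIMSEQ_zero[OF sum_eps]] .
  qed
  then have \<Phi>_eps: "(\<lambda>k. ereal (\<Phi> + \<epsilon> (j k))) \<longlonglongrightarrow> \<Phi>_min" if "strict_mono j" for j
    using LIMSEQ_subseq_LIMSEQ[OF _ that, of \<epsilon> 0] tendsto_add[OF tendsto_const[of \<Phi>], of "\<epsilon> \<circ> j" 0 sequentially]
    by (simp add: \<Phi> o_def)
  have FG: "ereal (f (x k)) + g (z k) = ereal (F k)" for k
    by (simp add: G F_def)
  have "liminf (\<lambda>k. ereal (F k)) \<le> liminf ((\<lambda>k. ereal (F k)) \<circ> s)"
    by (rule liminf_subseq_mono[OF s(1)])
  also have "\<dots> \<le> liminf (\<lambda>k. ereal (\<Phi> + \<epsilon> (s k)))"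
    using F_le_\<Phi>[OF s(2)] by (intro Liminf_mono always_eventually) simp
  also have "\<dots> = \<Phi>_min"
    by (rule lim_imp_Liminf[OF _ \<Phi>_eps[OF s(1)]]) simp
  finally have liminf_F: "liminf (\<lambda>k. ereal (f (x k)) + g (z k)) \<le> \<Phi>_min"
    by (simp only: FG)
  have bdd: "\<exists>xbar (r :: nat \<Rightarrow> nat). strict_mono r \<and> (\<lambda>k. x (r k)) \<longlonglongrightarrow> xbar \<and>
      minimizer (objective f g c) xbar \<and> (\<lambda>k. z (r k)) \<longlonglongrightarrow> c xbar \<and>
      (\<lambda>k. ereal (f (x (r k))) + g (z (r k))) \<longlonglongrightarrow> \<Phi>_min" if "bounded (range x)"
  proof -
    \<comment> \<open>Extracting from \<open>s\<close> keeps the upper bound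
      \<open>F_le_\<Phi>\<close> valid along the final subsequence.\<close>
    have "bounded (range (\<lambda>k. x (s k)))"
      using that by (rule bounded_subset) auto
    then obtain xbar t where t: "strict_mono (t :: nat \<Rightarrow> nat)" "((\<lambda>k. x (s k)) \<circ> t) \<longlonglongrightarrow> xbar"
      using bounded_imp_convergent_subsequence by blast
    define r where "r = s \<circ> t"
    have r: "strict_mono r"
      using s(1) t(1) by (simp add: r_def strict_mono_o)
    have xr: "(\<lambda>k. x (r k)) \<longlonglongrightarrow> xbar"
      using t(2) by (simp add: r_def o_def)
    have cr: "(\<lambda>k. c (x (r k))) \<longlonglongrightarrow> c xbar"
      using continuous_on_tendsto_compose[OF continuously_differentiable_imp_continuous_on[OF c(1)] xr] by simp
    have "(\<lambda>k. u (r k)) \<longlonglongrightarrow> 0"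
      using LIMSEQ_subseq_LIMSEQ[OF ppa(1) r] by (simp add: o_def)
    from tendsto_diff[OF cr this] have zr: "(\<lambda>k. z (r k)) \<longlonglongrightarrow> c xbar"
      by (simp add: u_def)
    \<comment> \<open>On the product space one lower semicontinuity argument covers the joint limit
      of \<open>x\<close> and \<open>z\<close>.\<close>
    have "continuous_on UNIV (\<lambda>p :: (real^'n) \<times> (real^'m). f (fst p))"
      by (rule continuous_on_compose2[OF continuously_differentiable_imp_continuous_on[OF f(1)]
            continuous_on_fst[OF continuous_on_id]]) simp
    moreover have "lsc_fun (\<lambda>p :: (real^'n) \<times> (real^'m). g (snd p))"
      by (rule lsc_fun_compose_continuous[OF g(2) continuous_on_snd[OF continuous_on_id]])
    moreover have "g w \<noteq> -\<infinity>" for w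
      using g(1) by (simp add: proper_fun_def)
    ultimately have "lsc_fun (\<lambda>p :: (real^'n) \<times> (real^'m). g (snd p) + ereal (f (fst p)))"
      by (intro lsc_fun_add_continuous)
    from lsc_fun_le_liminf[OF this tendsto_Pair[OF xr zr]]
    have low: "objective f g c xbar \<le> liminf (\<lambda>k. ereal (F (r k)))"
      by (simp add: objective_def G F_def add.commute)
    have "limsup (\<lambda>k. ereal (F (r k))) \<le> limsup (\<lambda>k. ereal (\<Phi> + \<epsilon> (r k)))"
      using F_le_\<Phi>[OF s(2)] by (intro Limsup_mono always_eventually) (simp add: r_def)
    also have "\<dots> = \<Phi>_min"
      by (rule lim_imp_Limsup[OF _ \<Phi>_eps[OF r]]) simp
    finally have up: "limsup (\<lambda>k. ereal (F (r k))) \<le> \<Phi>_min" .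
    have le: "liminf (\<lambda>k. ereal (F (r k))) \<le> limsup (\<lambda>k. ereal (F (r k)))"
      by (rule Liminf_le_Limsup) simp
    have \<Phi>_le: "\<Phi>_min \<le> objective f g c v" for v
      unfolding \<Phi>_min by (rule INF_lower) simp
    \<comment> \<open>The objective at \<open>xbar\<close> is at most the liminf, which is at most
      the limsup, which is at most \<open>\<Phi>_min\<close>. As \<open>\<Phi>_min\<close> is a
      lower bound of the objective, equality holds throughout.\<close>
    have "minimizer (objective f g c) xbar"
      unfolding minimizer_iff using \<Phi>_le low le up by (meson order_trans)
    moreover have "(\<lambda>k. ereal (F (r k))) \<longlonglongrightarrow> \<Phi>_min"
      using \<Phi>_le[of xbar] low le up by (intro Liminf_eq_Limsup) (auto intro: antisym order_trans)
    ultimately show ?thesis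
      using r xr zr by (auto simp: FG)
  qed
  show ?thesis
    using ppa(1) ppa(2) liminf_F bdd by (simp add: u_def[abs_def])
qed

end
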